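(* In continuous 2-player Guts, let $R_2(p_1^* )=\min_{p_2^*\in[0,1]}\alpha(p_1^*,p_2^* )$ be the best response payoff. Then the pure strategy $$p_1^*=\operatorname{argmax}_{p_1^*\in[0,1]}R_2(p_1^* )=\tfrac12$$ is optimal for player 1, guaranteeing a nonnegative (total expected) payoff.
   Context: Continuous 2-player Guts: players 1 and 2 receive independent hands $p_1,p_2$ uniform on $[0,1]$. A pure strategy of player $i$ is a threshold $p_i^*\in[0,1]$: hold if $p_i\ge p_i^*$, drop if $p_i<p_i^*$. Each ante is one unit. Let $r$ be the number of holding players. If $r=0$, the immediate return to both players is $0$ and the game is replayed with stakes factor $1$. If $r\ge1$, the stakes factor for the replay is $r-1$ (factor $0$ means the game ends) and a player's immediate return is $(r-2)+2$ if the player holds and has the highest hand among holders, $(r-2)-2$ if the player holds but does not have the highest hand, and $r-2$ if the player drops. $\alpha(p_1^*,p_2^* )$ is the expected immediate return to player 1, $\beta(p_1^*,p_2^* )$ the expected stakes factor. Both are extended to mixed strategies (probability measures on $[0,1]$) by averaging. Total return: player 1 may stop at any time by forfeiting the ante (fee equal to $1$ times current stakes). For a sequence $S=(\mu_1,\mu_2,\dots)$ of mixed strategies of player 1, the return guaranteed by $S$ in the $n$-truncated game is $g_n(S)=G_1$, where $G_{n+1}=-1$ and $G_k=\inf_{q\in[0,1]}\big[\alpha(\mu_k,q)+\beta(\mu_k,q)G_{k+1}\big]$ for $k=n,\dots,1$; $S$ guarantees return at least $c$ if $\sup_n g_n(S)\ge c$. A single-stage strategy is identified with the sequence repeating it in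 every round. A strategy is optimal if no strategy sequence has a larger guaranteed return $\sup_n g_n(S)$. *)

theory Defs
  imports "HOL-Probability.Probability"
begin

section \<open>One round of continuous two-player Guts\<close>

text \<open>Conventions: thresholds are \<open>p\<close> (player 1) and \<open>q\<close> (player 2), hands are \<open>x\<close> (player 1) and
  \<open>y\<close> (player 2).\<close>

definition player_holds :: "real \<Rightarrow> real \<Rightarrow> bool" where
  "player_holds threshold hand \<longleftrightarrow> threshold \<le> hand"

definition num_holding :: "real \<Rightarrow> real \<Rightarrow> real \<Rightarrow> real \<Rightarrow> nat" where
  "num_holding p q x y = of_bool (player_holds p x) + of_bool (player_holds q y)"

text \<open>Immediate return of player 1. If both hold with equal hands, player 1 counts as having the
  highest hand; this is a null event under the law of the hands below.\<close>

definition imm_return :: "real \<Rightarrow> real \<Rightarrow> real \<Rightarrow> real \<Rightarrow> real" where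
  "imm_return p q x y =
    (let r = num_holding p q x y in
     if r = 0 then 0
     else if player_holds p x then
       (if player_holds q y \<longrightarrow> y \<le> x then (real r - 2) + 2 else (real r - 2) - 2)
     else real r - 2)"

definition stakes_factor :: "real \<Rightarrow> real \<Rightarrow> real \<Rightarrow> real \<Rightarrow> real" where
  "stakes_factor p q x y =
    (let r = num_holding p q x y in if r = 0 then 1 else real r - 1)"

definition hands :: "(real \<times> real) measure" where
  "hands = uniform_measure lborel {0..1} \<Otimes>\<^sub>M uniform_measure lborel {0..1}"

definition alpha :: "real \<Rightarrow> real \<Rightarrow> real" where
  "alpha p q = (\<integral>(x, y). imm_return p q x y \<partial>hands)"

definition beta :: "real \<Rightarrow> real \<Rightarrow> real" where
  "beta p q = (\<integral>(x, y). stakes_factor p q x y \<partial>hands)"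

definition R2 :: "real \<Rightarrow> real" where
  "R2 p = (INF q\<in>{0..1}. alpha p q)"

section \<open>Mixed strategies and strategy sequences of player 1\<close>

definition mixed_strategies :: "real measure set" where
  "mixed_strategies = {\<mu>. prob_space \<mu> \<and> sets \<mu> = sets (restrict_space borel {0..1})}"

definition pure_strategy :: "real \<Rightarrow> real measure" where
  "pure_strategy p = return (restrict_space borel {0..1}) p"

definition alpha_mixed :: "real measure \<Rightarrow> real \<Rightarrow> real" where
  "alpha_mixed \<mu> q = (\<integral>p. alpha p q \<partial>\<mu>)"

definition beta_mixed :: "real measure \<Rightarrow> real \<Rightarrow> real" where
  "beta_mixed \<mu> q = (\<integral>p. beta p q \<partial>\<mu>)"

text \<open>Rounds are numbered from 1; the entry at index 0 of a sequence is never used.\<close>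

definition strategy_sequences :: "(nat \<Rightarrow> real measure) set" where
  "strategy_sequences = {S. \<forall>k. S k \<in> mixed_strategies}"

definition repeated :: "real measure \<Rightarrow> nat \<Rightarrow> real measure" where
  "repeated \<mu> = (\<lambda>k. \<mu>)"

section \<open>Guaranteed total return\<close>

text \<open>\<open>continuation_return S n k\<close> is the return guaranteed from round \<open>k\<close> on, per unit of current
  stakes, if player 1 forfeits the ante after round \<open>n\<close>. The real infimum is over a bounded set,
  since on \<open>{0..1}\<close> \<open>alpha\<close> has values in \<open>{-2..2}\<close> and \<open>beta\<close> in \<open>{0..1}\<close>.\<close>

function continuation_return :: "(nat \<Rightarrow> real measure) \<Rightarrow> nat \<Rightarrow> nat \<Rightarrow> real" where
  "continuation_return S n k =
    (if n < k then - 1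
     else (INF q\<in>{0..1}.
             alpha_mixed (S k) q + beta_mixed (S k) q * continuation_return S n (Suc k)))"
  by auto
termination
  by (relation "Wellfounded.measure (\<lambda>(S, n, k). Suc n - k)") auto

declare continuation_return.simps [simp del]

definition truncated_return :: "nat \<Rightarrow> (nat \<Rightarrow> real measure) \<Rightarrow> real" where
  "truncated_return n S = continuation_return S n 1"

text \<open>Extended reals, so that the supremum is meaningful without a prior bound.\<close>

definition guaranteed_return :: "(nat \<Rightarrow> real measure) \<Rightarrow> ereal" where
  "guaranteed_return S = (SUP n\<in>{1..}. ereal (truncated_return n S))"

definition guarantees_at_least :: "(nat \<Rightarrow> real measure) \<Rightarrow> real \<Rightarrow> bool" where
  "guarantees_at_least S c \<longleftrightarrow> ereal c \<le> guaranteed_return S"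

definition optimal :: "(nat \<Rightarrow> real measure) \<Rightarrow> bool" where
  "optimal S \<longleftrightarrow> S \<in> strategy_sequences \<and>
     (\<forall>T\<in>strategy_sequences. guaranteed_return T \<le> guaranteed_return S)"

end

theory Submission
  imports Defs
begin

text \<open>The immediate returns of a round sum to zero and, up to ties, a null event, the two players have
  the same role, so that \<^term>\<open>alpha\<close> is antisymmetric on the unit square; in fact \<open>alpha p q = (q - p) * (2 * q - 1)\<close> for \<open>p \<le> q\<close> (lemma \<open>alpha_eq\<close>).
  Hence the threshold one half never loses in expectation, whatever the opponent does
  (\<open>alpha_half_nonneg\<close>), while by antisymmetry an opponent who uses the threshold one half
  holds player 1 to a nonpositive immediate return (\<open>alpha_against_half_nonpos\<close>). Every other
  threshold of player 1 has a reply that makes the return strictly negative (\<open>R2_neg\<close>), so one half is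
  the unique maximiser of the best response payoff, with value zero.

  The total return follows from these two signs. Stakes factors are nonnegative, so if the
  opponent plays the threshold one half in every round, a continuation worth at most zero stays worth
  at most zero; since truncated games end with \<open>-1\<close>, no sequence of mixed strategies guarantees a positive return
  (\<open>guaranteed_return_nonpos\<close>). Conversely the threshold one half of player 1
  keeps the expected stakes factor at exactly one half whatever the opponent does. Each further round therefore halves the forfeited
  ante, the truncated returns are \<open>- (1/2)\<^sup>n\<close>, and their supremum is zero
  (\<open>guaranteed_return_half\<close>).\<close>

section \<open>The closed form of one round\<close>

abbreviation hand :: "real measure" where
  "hand \<equiv> uniform_measure lborel {0..1}"

lemma prob_space_hand: "prob_space hand"
  by (rule prob_space_uniform_measure) auto

lemma integral_hand:
  fixes f :: "real \<Rightarrow> real"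
  assumes "f \<in> borel_measurable borel"
  shows "(\<integral>x. f x \<partial>hand) = (\<integral>x. indicator {0..1} x * f x \<partial>lborel)"
proof -
  have "hand = density lborel (\<lambda>x. ennreal (indicator {0..1} x))"
    by (simp add: uniform_measure_def ennreal_indicator divide_ennreal_def)
  then show ?thesis
    using assms by (simp add: integral_density)
qed

lemma AE_hand_in_unit: "AE x in hand. x \<in> {0..1}"
  by (rule AE_uniform_measureI) auto

lemma AE_hand_neq: "AE x in hand. x \<noteq> c"
  by (rule AE_uniform_measureI, simp) (use AE_lborel_singleton[of c] in auto)

lemma integrable_hand:
  fixes f :: "real \<Rightarrow> real"
  assumes "f \<in> borel_measurable borel" "\<And>x. x \<in> {0..1} \<Longrightarrow> \<bar>f x\<bar> \<le> B"
  shows "integrable hand f"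
proof -
  interpret prob_space hand by (rule prob_space_hand)
  show ?thesis
    using assms AE_hand_in_unit
    by (intro integrable_const_bound[of _ B]) (auto elim!: eventually_mono simp del: atLeastAtMost_iff)
qed

lemma integral_hand_above:
  assumes "a \<in> {0..1}"
  shows "(\<integral>x. of_bool (a \<le> x) \<partial>hand) = 1 - a"
    and "(\<integral>x. of_bool (a \<le> x) * x \<partial>hand) = (1 - a\<^sup>2) / 2"
proof -
  have "(\<integral>x. of_bool (a \<le> x) \<partial>hand) = (\<integral>x. indicator {0..1} x * (of_bool (a \<le> x) :: real) \<partial>lborel)"
    by (rule integral_hand) simp
  also have "\<dots> = (\<integral>x. indicator {a..1} x \<partial>lborel)"
    using assms by (intro Bochner_Integration.integral_cong) (auto split: split_indicator)
  finally show "(\<integral>x. of_bool (a \<le> x) \<partial>hand) = 1 - a"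
    using assms by simp
  have "(\<integral>x. of_bool (a \<le> x) * x \<partial>hand) = (\<integral>x. indicator {0..1} x * (of_bool (a \<le> x) * x) \<partial>lborel)"
    by (rule integral_hand) simp
  also have "\<dots> = (\<integral>x. x * indicator {a..1} x \<partial>lborel)"
    using assms by (intro Bochner_Integration.integral_cong) (auto split: split_indicator)
  also have "\<dots> = 1\<^sup>2 / 2 - a\<^sup>2 / 2"
    using assms
    by (intro integral_FTC_Icc_real[where F = "\<lambda>x. x\<^sup>2 / 2"])
       (auto intro!: derivative_eq_intros)
  finally show "(\<integral>x. of_bool (a \<le> x) * x \<partial>hand) = (1 - a\<^sup>2) / 2"
    by (simp add: field_simps)
qed

text \<open>Fubini; the bound is what makes the payoff functions integrable.\<close>

lemma integral_hands:
  fixes f :: "real \<Rightarrow> real \<Rightarrow> real"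
  assumes [measurable]: "case_prod f \<in> borel_measurable (borel \<Otimes>\<^sub>M borel)"
    and bound: "\<And>x y. \<bar>f x y\<bar> \<le> B"
  shows "(\<integral>(x, y). f x y \<partial>hands) = (\<integral>x. (\<integral>y. f x y \<partial>hand) \<partial>hand)"
proof -
  interpret H: prob_space hand by (rule prob_space_hand)
  interpret P: pair_prob_space hand hand ..
  have "sets (hand \<Otimes>\<^sub>M hand) = sets (borel \<Otimes>\<^sub>M borel)"
    by (intro sets_pair_measure_cong) auto
  then have "case_prod f \<in> borel_measurable (hand \<Otimes>\<^sub>M hand)"
    using assms(1) by (simp cong: measurable_cong_sets)
  then have "integrable (hand \<Otimes>\<^sub>M hand) (case_prod f)"
    using bound by (intro P.integrable_const_bound[of _ B]) auto
  then show ?thesis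
    unfolding hands_def by (rule P.integral_fst[symmetric])
qed

text \<open>For a fixed hand of player 1 the return is a step function of the opponent's hand. The maximum of
  the thresholds appears because, when both hold, the opponent loses only with a hand below that of
  player 1, which requires player 1 to be above both thresholds. This form has no case distinction and
  is visibly continuous in each argument.\<close>

lemma alpha_max:
  assumes p: "p \<in> {0..1}" and q: "q \<in> {0..1}"
  shows "alpha p q = q - 1 + (1 - p) * (2 * q - 1) + 2 * (1 - (max p q)\<^sup>2) - 4 * q * (1 - max p q)"
proof -
  interpret H: prob_space hand by (rule prob_space_hand)
  have imm: "imm_return p q x y = (if x < p then - of_bool (q \<le> y)
     else if q \<le> y \<and> x < y then - 2 else 1 + of_bool (q \<le> y))" for x y
    by (auto simp: imm_return_def num_holding_def player_holds_def Let_def)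
  have meas: "(\<lambda>(x, y). imm_return p q x y) \<in> borel_measurable (borel \<Otimes>\<^sub>M borel)"
    unfolding imm by measurable
  have "alpha p q = (\<integral>x. (\<integral>y. imm_return p q x y \<partial>hand) \<partial>hand)"
    unfolding alpha_def by (rule integral_hands[OF meas, of 2]) (auto simp: imm)
  also have "\<dots> = (\<integral>x. (q - 1) + of_bool (p \<le> x) * (2 * q - 1) + 4 * (of_bool (max p q \<le> x) * x)
      - 4 * q * of_bool (max p q \<le> x) \<partial>hand)"
  proof (rule integral_cong_AE)
    show "(\<lambda>x. \<integral>y. imm_return p q x y \<partial>hand) \<in> borel_measurable hand"
    proof -
      have "(\<lambda>(x, y). imm_return p q x y) \<in> borel_measurable (hand \<Otimes>\<^sub>M hand)"
        using meas by (simp cong: measurable_cong_sets sets_pair_measure_cong)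
      then show ?thesis by (rule H.borel_measurable_lebesgue_integral)
    qed
    show "(\<lambda>x. (q - 1) + of_bool (p \<le> x) * (2 * q - 1) + 4 * (of_bool (max p q \<le> x) * x)
      - 4 * q * of_bool (max p q \<le> x)) \<in> borel_measurable hand"
      by measurable
    have inner: "(\<integral>y. imm_return p q x y \<partial>hand) = (q - 1) + of_bool (p \<le> x) * (2 * q - 1)
        + 4 * (of_bool (max p q \<le> x) * x) - 4 * q * of_bool (max p q \<le> x)"
      if x: "x \<in> {0..1}" for x
    proof (cases "x < p")
      case True
      then show ?thesis
        using integral_hand_above(1)[OF q] by (simp add: imm)
    next
      case False
      have m: "max q x \<in> {0..1}" using q x by auto
      have int: "integrable hand (\<lambda>y. of_bool (a \<le> y) :: real)" for a :: real
        by (rule integrable_hand[of _ 1]) auto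
      \<comment> \<open>Player 1 holds. The return is 1 if the opponent drops, 2 if the opponent holds and loses, and
        -2 if the opponent wins; a tie, where the right-hand side is wrong, is a null event.\<close>
      have "(\<integral>y. imm_return p q x y \<partial>hand)
          = (\<integral>y. 1 + of_bool (q \<le> y) - 4 * of_bool (max q x \<le> y) \<partial>hand)"
      proof (rule integral_cong_AE)
        show "imm_return p q x \<in> borel_measurable hand"
          unfolding imm by measurable
        show "AE y in hand. imm_return p q x y = 1 + of_bool (q \<le> y) - 4 * of_bool (max q x \<le> y)"
          using AE_hand_neq[of x] by eventually_elim (use False in \<open>auto simp: imm\<close>)
      qed measurable
      also have "\<dots> = 1 + (1 - q) - 4 * (1 - max q x)"
        using integral_hand_above(1)[OF q] integral_hand_above(1)[OF m] int
        by (simp add: H.prob_space del: space_uniform_measure max.bounded_iff)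
      finally show ?thesis
        using False by (auto simp: max_def algebra_simps)
    qed
    show "AE x in hand. (\<integral>y. imm_return p q x y \<partial>hand) = (q - 1) + of_bool (p \<le> x) * (2 * q - 1)
        + 4 * (of_bool (max p q \<le> x) * x) - 4 * q * of_bool (max p q \<le> x)"
      using AE_hand_in_unit by eventually_elim (rule inner)
  qed
  also have "\<dots> = (q - 1) + (1 - p) * (2 * q - 1) + 4 * ((1 - (max p q)\<^sup>2) / 2) - 4 * q * (1 - max p q)"
  proof -
    have m: "max p q \<in> {0..1}" using p q by auto
    have int: "integrable hand (\<lambda>y. of_bool (a \<le> y) :: real)" "integrable hand (\<lambda>y. of_bool (a \<le> y) * y)" for a :: real
      by (rule integrable_hand[of _ 1]; auto)+
    show ?thesis
      using integral_hand_above[OF m] integral_hand_above(1)[OF p] int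
      by (simp add: H.prob_space del: space_uniform_measure max.bounded_iff)
  qed
  finally show ?thesis by simp
qed

lemma alpha_eq:
  assumes "p \<in> {0..1}" "q \<in> {0..1}"
  shows "alpha p q = (if p \<le> q then (q - p) * (2 * q - 1) else (p - q) * (1 - 2 * p))"
  unfolding alpha_max[OF assms] by (auto simp: max_def algebra_simps power2_eq_square)

lemma beta_eq:
  assumes p: "p \<in> {0..1}" and q: "q \<in> {0..1}"
  shows "beta p q = p * q + (1 - p) * (1 - q)"
proof -
  interpret H: prob_space hand by (rule prob_space_hand)
  have st: "stakes_factor p q x y
      = 1 - of_bool (p \<le> x) + (2 * of_bool (p \<le> x) - 1) * of_bool (q \<le> y)" for x y
    by (auto simp: stakes_factor_def num_holding_def player_holds_def Let_def)
  have meas: "(\<lambda>(x, y). stakes_factor p q x y) \<in> borel_measurable (borel \<Otimes>\<^sub>M borel)"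
    unfolding st by measurable
  have int: "integrable hand (\<lambda>y. of_bool (a \<le> y) :: real)" for a :: real
    by (rule integrable_hand[of _ 1]) auto
  note simps = H.prob_space integral_hand_above(1)[OF p] integral_hand_above(1)[OF q] int
  have "beta p q = (\<integral>x. (\<integral>y. stakes_factor p q x y \<partial>hand) \<partial>hand)"
    unfolding beta_def by (rule integral_hands[OF meas, of 1]) (auto simp: st)
  also have "\<dots> = (\<integral>x. 1 - of_bool (p \<le> x) + (2 * of_bool (p \<le> x) - 1) * (1 - q) \<partial>hand)"
    by (simp add: st simps del: space_uniform_measure max.bounded_iff)
  also have "\<dots> = p * q + (1 - p) * (1 - q)"
    by (simp add: simps algebra_simps del: space_uniform_measure max.bounded_iff)
  finally show ?thesis .
qed

section \<open>The best response to a pure threshold\<close>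

lemma continuous_on_alpha:
  assumes "p \<in> {0..1}"
  shows "continuous_on {0..1} (alpha p)" and "continuous_on {0..1} (\<lambda>x. alpha x p)"
proof -
  let ?f = "\<lambda>p q::real. q - 1 + (1 - p) * (2 * q - 1) + 2 * (1 - (max p q)\<^sup>2) - 4 * q * (1 - max p q)"
  have "continuous_on {0..1} (?f p)" "continuous_on {0..1} (\<lambda>x. ?f x p)"
    by (intro continuous_intros)+
  then show "continuous_on {0..1} (alpha p)" "continuous_on {0..1} (\<lambda>x. alpha x p)"
    using assms by (auto simp: alpha_max simp del: atLeastAtMost_iff cong: continuous_on_cong_simp)
qed

lemma best_response_attained:
  assumes p: "p \<in> {0..1}"
  obtains q where "q \<in> {0..1}" "is_arg_min (alpha p) (\<lambda>q. q \<in> {0..1}) q" "R2 p = alpha p q"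
proof -
  obtain q where q: "q \<in> {0..1}" "\<forall>q'\<in>{0..1}. alpha p q \<le> alpha p q'"
    using continuous_attains_inf[OF _ _ continuous_on_alpha(1)[OF p]] by auto
  have "R2 p = alpha p q"
    unfolding R2_def using q by (intro cInf_eq_minimum) auto
  with q show thesis by (intro that) (auto simp: is_arg_min_linorder)
qed

lemma R2_le_alpha:
  assumes p: "p \<in> {0..1}" and q: "q \<in> {0..1}"
  shows "R2 p \<le> alpha p q"
proof -
  obtain q0 where "is_arg_min (alpha p) (\<lambda>q. q \<in> {0..1}) q0" "R2 p = alpha p q0"
    using best_response_attained[OF p] by blast
  with q show ?thesis by (auto simp: is_arg_min_linorder)
qed

lemma alpha_half_nonneg:
  assumes "q \<in> {0..1}"
  shows "0 \<le> alpha (1/2) q"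
  using assms by (auto simp: alpha_eq)

lemma alpha_against_half_nonpos:
  assumes "p \<in> {0..1}"
  shows "alpha p (1/2) \<le> 0"
  using assms by (auto simp: alpha_eq mult_nonneg_nonpos)

lemma R2_half: "R2 (1/2) = 0"
proof -
  obtain q where "q \<in> {0..1}" "R2 (1/2) = alpha (1/2) q"
    using best_response_attained[of "1/2"] by auto
  moreover have "R2 (1/2) \<le> alpha (1/2) (1/2)"
    by (rule R2_le_alpha) auto
  ultimately show ?thesis
    using alpha_half_nonneg[of q] by (simp add: alpha_eq)
qed

text \<open>If player 1 plays too loosely, a slightly more selective opponent gains; the reply half way
  between the threshold of player 1 and one half minimises the return. If player 1 plays too
  tightly, an opponent who always holds gains by collecting the antes.\<close>

lemma R2_neg:
  assumes p: "p \<in> {0..1}" and "p \<noteq> 1/2"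
  shows "R2 p < 0"
proof (cases "p < 1/2")
  case True
  have "R2 p \<le> alpha p ((p + 1/2) / 2)"
    using p True by (intro R2_le_alpha) auto
  also have "\<dots> = - ((1/2 - p)\<^sup>2 / 2)"
    using p True by (simp add: alpha_eq power2_eq_square field_simps)
  also have "\<dots> < 0"
    using True by simp
  finally show ?thesis .
next
  case False
  have "R2 p \<le> alpha p 0"
    using p by (intro R2_le_alpha) auto
  also have "\<dots> < 0"
    using p False \<open>p \<noteq> 1/2\<close> by (auto simp: alpha_eq mult_pos_neg)
  finally show ?thesis .
qed

section \<open>Sequences of mixed strategies\<close>

text \<open>The bound \<open>a\<close> has to be nonpositive because the integral of a non-integrable function is zero by
  convention.\<close>

lemma mixed_integral_ge:
  fixes f :: "real \<Rightarrow> real"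
  assumes "\<mu> \<in> mixed_strategies" and "\<And>p. p \<in> {0..1} \<Longrightarrow> a \<le> f p" "a \<le> 0"
  shows "a \<le> (\<integral>p. f p \<partial>\<mu>)"
proof -
  interpret prob_space \<mu> using assms(1) by (simp add: mixed_strategies_def)
  have sp: "space \<mu> = {0..1}"
    using assms(1) sets_eq_imp_space_eq[of \<mu> "restrict_space borel {0..1}"]
    by (simp add: mixed_strategies_def space_restrict_space)
  show ?thesis
  proof (cases "integrable \<mu> f")
    case True
    then show ?thesis using assms(2) sp by (intro integral_ge_const) auto
  next
    case False
    then show ?thesis using assms(3) by (simp add: not_integrable_integral_eq)
  qed
qed

lemma alpha_mixed_ge:
  assumes "\<mu> \<in> mixed_strategies" "q \<in> {0..1}"
  shows "- 1 \<le> alpha_mixed \<mu> q"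
  unfolding alpha_mixed_def
proof (rule mixed_integral_ge[OF assms(1)])
  fix p :: real assume p: "p \<in> {0..1}"
  have 1: "x * y \<le> 1" if "0 \<le> x" "x \<le> 1" "\<bar>y\<bar> \<le> 1" for x y :: real
    using mult_mono[of x 1 "\<bar>y\<bar>" 1] that abs_ge_self[of "x*y"] by (simp add: abs_mult)
  show "- 1 \<le> alpha p q"
    using p assms(2) 1[of "q - p" "1 - 2 * q"] 1[of "p - q" "2 * p - 1"]
    by (auto simp: alpha_eq algebra_simps abs_le_iff)
qed simp

lemma beta_nonneg:
  assumes "p \<in> {0..1}" "q \<in> {0..1}"
  shows "0 \<le> beta p q"
  using assms by (simp add: beta_eq)

lemma beta_mixed_nonneg:
  assumes "\<mu> \<in> mixed_strategies" "q \<in> {0..1}"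
  shows "0 \<le> beta_mixed \<mu> q"
  unfolding beta_mixed_def by (rule mixed_integral_ge[OF assms(1)]) (use assms in \<open>auto intro: beta_nonneg\<close>)

lemma beta_mixed_le_one:
  assumes "\<mu> \<in> mixed_strategies" "q \<in> {0..1}"
  shows "beta_mixed \<mu> q \<le> 1"
proof -
  have "- 1 \<le> (\<integral>p. - beta p q \<partial>\<mu>)"
  proof (rule mixed_integral_ge[OF assms(1)])
    fix p :: real assume p: "p \<in> {0..1}"
    have "p * q + (1 - p) * (1 - q) \<le> p * 1 + (1 - p) * 1"
      using p assms(2) by (intro add_mono mult_left_mono) auto
    then show "- 1 \<le> - beta p q" using p assms(2) by (simp add: beta_eq)
  qed simp
  then show ?thesis by (simp add: beta_mixed_def)
qed

lemma alpha_mixed_half_nonpos: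
  assumes "\<mu> \<in> mixed_strategies"
  shows "alpha_mixed \<mu> (1/2) \<le> 0"
proof -
  have "0 \<le> (\<integral>p. - alpha p (1/2) \<partial>\<mu>)"
    by (rule mixed_integral_ge[OF assms]) (use alpha_against_half_nonpos in auto)
  then show ?thesis by (simp add: alpha_mixed_def)
qed

text \<open>The opponent's threshold one half makes the immediate return nonpositive against every mixed
  strategy, and a nonnegative multiple of a nonpositive continuation does not help player 1.\<close>

lemma continuation_return_nonpos:
  assumes S: "S \<in> strategy_sequences"
  shows "continuation_return S n k \<le> 0"
proof (induction "Suc n - k" arbitrary: k)
  case 0
  then show ?case by (simp add: continuation_return.simps)
next
  case (Suc m)
  let ?G = "continuation_return S n (Suc k)"
  let ?v = "\<lambda>q. alpha_mixed (S k) q + beta_mixed (S k) q * ?G"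
  have Sk: "S k \<in> mixed_strategies" using S by (simp add: strategy_sequences_def)
  have G: "?G \<le> 0" using Suc by (intro Suc.hyps) auto
  \<comment> \<open>A real infimum is a lower bound only for a set bounded below.\<close>
  have "- 1 + ?G \<le> ?v q" if "q \<in> {0..1}" for q
    using alpha_mixed_ge[OF Sk that] mult_right_mono_neg[OF beta_mixed_le_one[OF Sk that] G] by simp
  then have "bdd_below (?v ` {0..1})" by (intro bdd_belowI2)
  then have "(INF q\<in>{0..1}. ?v q) \<le> ?v (1/2)" by (rule cINF_lower) auto
  also have "\<dots> \<le> 0"
    using alpha_mixed_half_nonpos[OF Sk] beta_mixed_nonneg[OF Sk, of "1/2"] G
      mult_nonneg_nonpos[of "beta_mixed (S k) (1/2)" ?G] by simp
  finally show ?case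
    using Suc(2) by (subst continuation_return.simps) simp
qed

lemma guaranteed_return_nonpos:
  assumes "S \<in> strategy_sequences"
  shows "guaranteed_return S \<le> 0"
  unfolding guaranteed_return_def truncated_return_def
  using continuation_return_nonpos[OF assms] by (intro SUP_least) (simp add: zero_ereal_def)

section \<open>Repeating the threshold one half\<close>

lemma pure_strategy_mixed:
  assumes "p \<in> {0..1}"
  shows "pure_strategy p \<in> mixed_strategies"
  using assms
  by (auto simp: mixed_strategies_def pure_strategy_def space_restrict_space intro!: prob_space_return)

lemma integral_pure_strategy:
  fixes f :: "real \<Rightarrow> real"
  assumes "p \<in> {0..1}" "continuous_on {0..1} f"
  shows "(\<integral>x. f x \<partial>pure_strategy p) = f p"
  unfolding pure_strategy_def using assms
  by (intro integral_return borel_measurable_continuous_on_restrict) (auto simp: space_restrict_space)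

lemma alpha_mixed_pure:
  assumes "p \<in> {0..1}" "q \<in> {0..1}"
  shows "alpha_mixed (pure_strategy p) q = alpha p q"
  unfolding alpha_mixed_def using assms by (intro integral_pure_strategy continuous_on_alpha(2))

lemma beta_mixed_pure:
  assumes "p \<in> {0..1}" "q \<in> {0..1}"
  shows "beta_mixed (pure_strategy p) q = beta p q"
  unfolding beta_mixed_def
proof (rule integral_pure_strategy[OF assms(1)])
  have "continuous_on {0..1} (\<lambda>p. p * q + (1 - p) * (1 - q))"
    by (intro continuous_intros)
  then show "continuous_on {0..1} (\<lambda>p. beta p q)"
    using assms(2) by (auto simp: beta_eq simp del: atLeastAtMost_iff cong: continuous_on_cong_simp)
qed

text \<open>The expected stakes factor is one half against every reply, so the opponent can only minimise the
  immediate return, whose minimum is zero; the final loss of one ante is halved in each round.\<close>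

lemma continuation_return_half:
  "continuation_return (repeated (pure_strategy (1/2))) n k = - ((1/2) ^ (Suc n - k))"
proof (induction "Suc n - k" arbitrary: k)
  case 0
  then show ?case by (simp add: continuation_return.simps)
next
  case (Suc m)
  let ?S = "repeated (pure_strategy (1/2))"
  let ?G = "continuation_return ?S n (Suc k)"
  have "(INF q\<in>{0..1}. alpha_mixed (?S k) q + beta_mixed (?S k) q * ?G)
      = (INF q\<in>{0..1}. alpha (1/2) q + ?G / 2)"
    by (intro INF_cong) (auto simp: repeated_def alpha_mixed_pure beta_mixed_pure beta_eq field_simps)
  also have "\<dots> = ?G / 2"
  proof (rule cInf_eq_minimum)
    have "alpha (1/2) (1/2) = 0" by (simp add: alpha_eq)
    then show "?G / 2 \<in> (\<lambda>q. alpha (1/2) q + ?G / 2) ` {0..1}"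
      by (intro image_eqI[of _ _ "1/2"]) auto
  qed (use alpha_half_nonneg in auto)
  finally have "continuation_return ?S n k = ?G / 2"
    using Suc(2) continuation_return.simps[of ?S n k] by (cases "n < k") auto
  also have "?G = - ((1/2) ^ (Suc n - Suc k))"
    using Suc(2) by (intro Suc.hyps) auto
  finally show ?case
    using Suc(2) by (simp add: Suc_diff_le)
qed

lemma guaranteed_return_half: "0 \<le> guaranteed_return (repeated (pure_strategy (1/2)))"
proof (rule LIMSEQ_le_const2)
  have "(\<lambda>n. - ((1/2) ^ n) :: real) \<longlonglongrightarrow> - 0"
    by (intro tendsto_minus LIMSEQ_power_zero) simp
  then show "(\<lambda>n. ereal (- ((1/2) ^ n))) \<longlonglongrightarrow> 0"
    by (simp add: zero_ereal_def)
  have "ereal (- ((1/2) ^ n)) \<le> guaranteed_return (repeated (pure_strategy (1/2)))" if "1 \<le> n" for n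
    unfolding guaranteed_return_def truncated_return_def continuation_return_half
    using that by (intro SUP_upper2[of n]) auto
  then show "\<exists>N. \<forall>n\<ge>N. ereal (- ((1/2) ^ n)) \<le> guaranteed_return (repeated (pure_strategy (1/2)))"
    by blast
qed

section \<open>Optimality of the threshold one half\<close>

theorem corollary5p4:
  "(\<forall>p\<in>{0..1}. \<exists>q. is_arg_min (alpha p) (\<lambda>q. q \<in> {0..1}) q \<and> R2 p = alpha p q) \<and>
   {p. is_arg_max R2 (\<lambda>p. p \<in> {0..1}) p} = {1/2} \<and>
   optimal (repeated (pure_strategy (1/2))) \<and>
   guarantees_at_least (repeated (pure_strategy (1/2))) 0"
proof (intro conjI ballI)
  fix p :: real assume "p \<in> {0..1}"
  then show "\<exists>q. is_arg_min (alpha p) (\<lambda>q. q \<in> {0..1}) q \<and> R2 p = alpha p q"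
    using best_response_attained by blast
next
  have "R2 p \<le> 0" if "p \<in> {0..1}" for p
    using R2_neg[OF that] R2_half by (cases "p = 1/2") (auto simp del: eq_divide_eq_numeral1)
  then have "is_arg_max R2 (\<lambda>p. p \<in> {0..1}) (1/2)"
    using R2_half by (simp add: is_arg_max_linorder)
  moreover have "p = 1/2" if "is_arg_max R2 (\<lambda>p. p \<in> {0..1}) p" for p
  proof (rule ccontr)
    assume "p \<noteq> 1/2"
    with that have "R2 p < 0" by (intro R2_neg) (auto simp: is_arg_max_linorder)
    moreover have "R2 (1/2) \<le> R2 p" using that by (auto simp: is_arg_max_linorder)
    ultimately show False using R2_half by simp
  qed
  ultimately show "{p. is_arg_max R2 (\<lambda>p. p \<in> {0..1}) p} = {1/2}" by auto
next
  have "repeated (pure_strategy (1/2)) \<in> strategy_sequences"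
    by (simp add: strategy_sequences_def repeated_def pure_strategy_mixed)
  then show "optimal (repeated (pure_strategy (1/2)))"
    unfolding optimal_def using guaranteed_return_nonpos guaranteed_return_half
    by (auto intro: order_trans)
next
  show "guarantees_at_least (repeated (pure_strategy (1/2))) 0"
    using guaranteed_return_half by (simp add: guarantees_at_least_def zero_ereal_def)
qed

end
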